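(* Let $S$ be a discrete semigroup, let $T$ be a closed subsemigroup of $\beta S$, let $\mathcal{F}$ be a filter on $S$ such that $\overline{\mathcal{F}}=T$, and let $\mathcal{A}\subseteq\mathcal{P}(S)$. Then there exists $p\in K(T)$ such that $\mathcal{A}\subseteq p$ if and only if $\mathcal{A}$ is collectionwise piecewise $\mathcal{F}$-syndetic.
   Context: $\beta S$ is the space of ultrafilters on $S$, with basic sets $\overline{A}=\{p\in\beta S: A\in p\}$. For $x\in S$, $A,G\subseteq S$ put $x^{-1}A=\{y\in S: xy\in A\}$ and $G^{-1}A=\bigcup_{x\in G}x^{-1}A$. The operation on $\beta S$: $A\in p\cdot q$ iff $\{x\in S: x^{-1}A\in q\}\in p$. $\overline{\mathcal{F}}=\{p\in\beta S:\mathcal{F}\subseteq p\}$. A closed subsemigroup is nonempty; $K(T)$ is the smallest two-sided ideal of the compact right topological semigroup $T$. $\mathcal{P}(S)$ is the power set of $S$ and $\mathcal{P}_f(Y)$ is the set of finite nonempty subsets of $Y$. A family $\mathcal{A}\subseteq\mathcal{P}(S)$ is collectionwise piecewise $\mathcal{F}$-syndetic if for every $V\in\mathcal{F}$ there exist functions $G_V:\mathcal{P}_f(\mathcal{A})\to\mathcal{P}_f(V)$ and $\delta_V:\mathcal{P}_f(\mathcal{A})\to\mathcal{F}$ such that the family $\{y^{-1}(G_V(\mathcal{B}))^{-1}(\bigcap\mathcal{B})\cap V: V\in\mathcal{F},\ y\in\delta_V(\mathcal{B}),\ \mathcal{B}\in\mathcal{P}_f(\mathcal{A})\}$ has the finite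 intersection property. *)

theory Defs
  imports "HOL-Analysis.Analysis"
begin

definition members :: "'a filter \<Rightarrow> 'a set set" where
  "members F = {A. \<forall>\<^sub>F x in F. x \<in> A}"

definition is_ultrafilter :: "'a filter \<Rightarrow> bool" where
  "is_ultrafilter p \<longleftrightarrow> p \<noteq> bot \<and> (\<forall>A. A \<in> members p \<or> - A \<in> members p)"

lemma is_ultrafilter_principal: "is_ultrafilter (principal {x})"
  by (auto simp: is_ultrafilter_def members_def eventually_principal principal_eq_bot_iff)

typedef 'a ultrafilter = "{p :: 'a filter. is_ultrafilter p}"
  using is_ultrafilter_principal by (metis mem_Collect_eq)

definition uf_sets :: "'a ultrafilter \<Rightarrow> 'a set set" where
  "uf_sets p = members (Rep_ultrafilter p)"

definition basic_set :: "'a set \<Rightarrow> 'a ultrafilter set" where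
  "basic_set A = {p. A \<in> uf_sets p}"

lemma basic_set_Int: "basic_set (A \<inter> B) = basic_set A \<inter> basic_set B"
  by (auto simp: basic_set_def uf_sets_def members_def eventually_conj_iff)

lemma basic_set_UNIV: "basic_set UNIV = UNIV"
  by (auto simp: basic_set_def uf_sets_def members_def)

instantiation ultrafilter :: (type) topological_space
begin

definition open_ultrafilter :: "'a ultrafilter set \<Rightarrow> bool" where
  "open_ultrafilter U \<longleftrightarrow> (\<forall>p\<in>U. \<exists>A. p \<in> basic_set A \<and> basic_set A \<subseteq> U)"

instance
proof
  show "open (UNIV :: 'a ultrafilter set)"
    unfolding open_ultrafilter_def using basic_set_UNIV by blast
next
  fix U V :: "'a ultrafilter set"
  assume UV: "open U" "open V"
  show "open (U \<inter> V)"
    unfolding open_ultrafilter_def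
  proof
    fix p assume p: "p \<in> U \<inter> V"
    obtain A B where "p \<in> basic_set A" "basic_set A \<subseteq> U" "p \<in> basic_set B" "basic_set B \<subseteq> V"
      using p UV unfolding open_ultrafilter_def by blast
    then show "\<exists>C. p \<in> basic_set C \<and> basic_set C \<subseteq> U \<inter> V"
      by (intro exI[of _ "A \<inter> B"]) (auto simp: basic_set_Int)
  qed
next
  fix K :: "'a ultrafilter set set"
  assume "\<forall>U\<in>K. open U"
  then show "open (\<Union>K)"
    unfolding open_ultrafilter_def by (meson Union_iff Union_upper order_trans)
qed

end

text \<open>\<open>left_quot x A\<close> is \<open>x\<^sup>-\<^sup>1A\<close>, and \<open>Left_quot G A\<close> is \<open>G\<^sup>-\<^sup>1A\<close>; no inverses are involved.\<close>

definition left_quot :: "'a::times \<Rightarrow> 'a set \<Rightarrow> 'a set" where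
  "left_quot x A = {y. x * y \<in> A}"

definition Left_quot :: "'a::times set \<Rightarrow> 'a set \<Rightarrow> 'a set" where
  "Left_quot G A = (\<Union>x\<in>G. left_quot x A)"

definition filter_mult :: "'a::times filter \<Rightarrow> 'a filter \<Rightarrow> 'a filter" where
  "filter_mult p q = Abs_filter (\<lambda>P. \<forall>\<^sub>F x in p. \<forall>\<^sub>F y in q. P (x * y))"

lemma eventually_filter_mult:
  "eventually P (filter_mult p q) \<longleftrightarrow> (\<forall>\<^sub>F x in p. \<forall>\<^sub>F y in q. P (x * y))"
  unfolding filter_mult_def
proof (rule eventually_Abs_filter, rule is_filter.intro)
  fix P Q :: "'a \<Rightarrow> bool"
  assume "\<forall>x. P x \<longrightarrow> Q x" "\<forall>\<^sub>F x in p. \<forall>\<^sub>F y in q. P (x * y)"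
  then show "\<forall>\<^sub>F x in p. \<forall>\<^sub>F y in q. Q (x * y)"
    by (auto elim!: eventually_mono)
qed (auto simp: eventually_conj_iff)

lemma members_filter_mult:
  "A \<in> members (filter_mult p q) \<longleftrightarrow> {x. left_quot x A \<in> members q} \<in> members p"
  by (simp add: members_def left_quot_def eventually_filter_mult)

lemma is_ultrafilter_filter_mult:
  assumes p: "is_ultrafilter p" and q: "is_ultrafilter q"
  shows "is_ultrafilter (filter_mult p q)"
proof -
  have "filter_mult p q \<noteq> bot"
    using p q by (simp add: is_ultrafilter_def trivial_limit_def eventually_filter_mult)
  moreover have "A \<in> members (filter_mult p q) \<or> - A \<in> members (filter_mult p q)" for A
  proof (cases "{x. left_quot x A \<in> members q} \<in> members p")
    case False
    then have "- {x. left_quot x A \<in> members q} \<in> members p"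
      using p by (auto simp: is_ultrafilter_def)
    moreover have "- {x. left_quot x A \<in> members q} \<subseteq> {x. left_quot x (- A) \<in> members q}"
      using q by (auto simp: is_ultrafilter_def left_quot_def Compl_eq)
    ultimately have "{x. left_quot x (- A) \<in> members q} \<in> members p"
      unfolding members_def[of p] by (auto elim!: eventually_mono)
    then show ?thesis
      by (simp add: members_filter_mult)
  qed (simp add: members_filter_mult)
  ultimately show ?thesis
    by (simp add: is_ultrafilter_def)
qed

instantiation ultrafilter :: (times) times
begin

definition times_ultrafilter :: "'a ultrafilter \<Rightarrow> 'a ultrafilter \<Rightarrow> 'a ultrafilter" where
  "times_ultrafilter p q = Abs_ultrafilter (filter_mult (Rep_ultrafilter p) (Rep_ultrafilter q))"

instance ..

end

lemma uf_sets_times: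
  "A \<in> uf_sets (p * q) \<longleftrightarrow> {x. left_quot x A \<in> uf_sets q} \<in> uf_sets p"
proof -
  have "Rep_ultrafilter (p * q) = filter_mult (Rep_ultrafilter p) (Rep_ultrafilter q)"
    unfolding times_ultrafilter_def
    using Rep_ultrafilter[of p] Rep_ultrafilter[of q]
    by (intro Abs_ultrafilter_inverse) (simp add: is_ultrafilter_filter_mult)
  then show ?thesis
    by (simp add: uf_sets_def members_filter_mult)
qed

lemma uf_sets_inject: "uf_sets p = uf_sets q \<longleftrightarrow> p = q"
proof
  assume *: "uf_sets p = uf_sets q"
  have "eventually P (Rep_ultrafilter p) = eventually P (Rep_ultrafilter q)" for P
    using * by (auto simp: uf_sets_def members_def set_eq_iff dest: spec[of _ "Collect P"])
  then show "p = q"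
    by (simp add: filter_eq_iff flip: Rep_ultrafilter_inject)
qed simp

instance ultrafilter :: (semigroup_mult) semigroup_mult
proof
  fix p q r :: "'a ultrafilter"
  have "A \<in> uf_sets (p * q * r) \<longleftrightarrow> A \<in> uf_sets (p * (q * r))" for A
    by (simp add: uf_sets_times) (simp add: left_quot_def mult.assoc uf_sets_times)
  then show "p * q * r = p * (q * r)"
    by (simp add: set_eq_iff flip: uf_sets_inject)
qed

definition filter_closure :: "'a filter \<Rightarrow> 'a ultrafilter set" where
  "filter_closure F = {p. members F \<subseteq> uf_sets p}"

definition closed_subsemigroup :: "'a::{times, topological_space} set \<Rightarrow> bool" where
  "closed_subsemigroup T \<longleftrightarrow> T \<noteq> {} \<and> closed T \<and> (\<forall>s\<in>T. \<forall>t\<in>T. s * t \<in> T)"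

definition two_sided_ideal :: "'a::times set \<Rightarrow> 'a set \<Rightarrow> bool" where
  "two_sided_ideal T I \<longleftrightarrow>
     I \<noteq> {} \<and> I \<subseteq> T \<and> (\<forall>t\<in>T. \<forall>i\<in>I. t * i \<in> I \<and> i * t \<in> I)"

text \<open>\<open>LEAST\<close> is with respect to inclusion. Existence of the smallest ideal is not built into
  this definition; for compact right topological semigroups it is a theorem.\<close>

definition smallest_ideal :: "'a::times set \<Rightarrow> 'a set" where
  "smallest_ideal T = (LEAST I. two_sided_ideal T I)"

definition finite_nonempty_subsets :: "'a set \<Rightarrow> 'a set set" where
  "finite_nonempty_subsets Y = {B. B \<subseteq> Y \<and> finite B \<and> B \<noteq> {}}"

definition finite_intersection_property :: "'a set set \<Rightarrow> bool" where
  "finite_intersection_property \<C> \<longleftrightarrow> (\<forall>\<B>\<in>finite_nonempty_subsets \<C>. \<Inter>\<B> \<noteq> {})"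

text \<open>The functions \<open>G\<^sub>V\<close> and \<open>\<delta>\<^sub>V\<close> are chosen for all \<open>V\<close> simultaneously: the family required
  to have the finite intersection property ranges over all members \<open>V\<close> of the filter.\<close>

definition collectionwise_piecewise_syndetic ::
    "'a::times filter \<Rightarrow> 'a set set \<Rightarrow> bool" where
  "collectionwise_piecewise_syndetic F \<A> \<longleftrightarrow>
     (\<exists>(G :: 'a set \<Rightarrow> 'a set set \<Rightarrow> 'a set) (\<delta> :: 'a set \<Rightarrow> 'a set set \<Rightarrow> 'a set).
        (\<forall>V\<in>members F.
           G V \<in> finite_nonempty_subsets \<A> \<rightarrow> finite_nonempty_subsets V \<and>
           \<delta> V \<in> finite_nonempty_subsets \<A> \<rightarrow> members F) \<and>
        finite_intersection_property
          {left_quot y (Left_quot (G V \<B>) (\<Inter>\<B>)) \<inter> V | V y \<B>.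
             V \<in> members F \<and> \<B> \<in> finite_nonempty_subsets \<A> \<and> y \<in> \<delta> V \<B>})"

end

theory Submission
  imports Defs
begin

text \<open>
  A point \<open>p\<close> lies in \<open>K(T)\<close> iff \<open>p \<in> T r p\<close> for every \<open>r \<in> T\<close>. If \<open>A \<in> p \<in> K(T)\<close> and \<open>V \<in> F\<close>,
  then \<open>p = s r p\<close> provides for each \<open>r \<in> T\<close> an \<open>x \<in> V\<close> with \<open>{y. y\<^sup>-\<^sup>1x\<^sup>-\<^sup>1A \<in> p} \<in> r\<close>; compactness of
  \<open>T\<close> leaves finitely many such \<open>x\<close>, which form \<open>G\<close>, and then \<open>\<delta> = {y. y\<^sup>-\<^sup>1G\<^sup>-\<^sup>1A \<in> p}\<close> belongs to
  every point of \<open>T\<close> and hence to \<open>F\<close>. Conversely, an ultrafilter \<open>q\<close> extending the family is in \<open>T\<close>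
  and satisfies \<open>G\<^sup>-\<^sup>1(\<Inter>\<B>) \<in> r q\<close> for all \<open>r \<in> T\<close>. For \<open>r \<in> K(T)\<close> and \<open>u = r q \<in> K(T)\<close>, the sets
  \<open>{x. x\<^sup>-\<^sup>1A \<in> u}\<close> together with \<open>F\<close> have the finite intersection property, and an ultrafilter \<open>s\<close>
  containing them yields \<open>s u \<in> K(T)\<close> with \<open>\<A> \<subseteq> s u\<close>.
\<close>

section \<open>Ultrafilters\<close>

text \<open>Zorn's lemma for the reversed order, with \<open>ne\<close> bounding the empty chain. It
  serves twice: ultrafilters are minimal proper filters, and K(T) is reached through minimal closed
  left ideals.\<close>

lemma Zorn_minimal:
  fixes S :: "'b::order set"
  assumes ne: "S \<noteq> {}"
    and lb: "\<And>C. C \<subseteq> S \<Longrightarrow> C \<noteq> {} \<Longrightarrow> (\<And>x y. x \<in> C \<Longrightarrow> y \<in> C \<Longrightarrow> x \<le> y \<or> y \<le> x) \<Longrightarrow> \<exists>l\<in>S. \<forall>x\<in>C. l \<le> x"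
  shows "\<exists>m\<in>S. \<forall>x\<in>S. x \<le> m \<longrightarrow> x = m"
proof (rule predicate_Zorn)
  show "partial_order_on S (relation_of (\<ge>) S)"
    by (rule partial_order_on_relation_ofI) auto
  show "\<exists>l\<in>S. \<forall>x\<in>C. x \<ge> l" if "C \<in> Chains (relation_of (\<ge>) S)" for C
  proof (cases "C = {}")
    case False
    with that show ?thesis
      by (intro lb) (auto simp: Chains_def relation_of_def)
  qed (use ne in auto)
qed

lemma uf_sets_mono: "A \<in> uf_sets p \<Longrightarrow> A \<subseteq> B \<Longrightarrow> B \<in> uf_sets p"
  by (auto simp: uf_sets_def members_def elim: eventually_mono)

lemma uf_sets_Int: "A \<inter> B \<in> uf_sets p \<longleftrightarrow> A \<in> uf_sets p \<and> B \<in> uf_sets p"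
  by (simp add: uf_sets_def members_def eventually_conj_iff)

lemma uf_sets_UNIV: "UNIV \<in> uf_sets p"
  by (simp add: uf_sets_def members_def)

lemma uf_sets_empty: "{} \<notin> uf_sets p"
  using Rep_ultrafilter[of p]
  by (auto simp: uf_sets_def members_def is_ultrafilter_def trivial_limit_def)

lemma uf_sets_Compl: "- A \<in> uf_sets p \<longleftrightarrow> A \<notin> uf_sets p"
proof
  show "A \<notin> uf_sets p" if "- A \<in> uf_sets p"
    using that uf_sets_Int[of A "- A" p] by (auto simp: uf_sets_empty)
  show "- A \<in> uf_sets p" if "A \<notin> uf_sets p"
    using that Rep_ultrafilter[of p] by (auto simp: uf_sets_def is_ultrafilter_def)
qed

lemma uf_sets_finite_Inter:
  assumes "finite \<B>"
  shows "\<Inter>\<B> \<in> uf_sets p \<longleftrightarrow> \<B> \<subseteq> uf_sets p"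
  using assms by induction (auto simp: uf_sets_UNIV uf_sets_Int)

lemma uf_sets_finite_UN:
  assumes "finite G"
  shows "(\<Union>x\<in>G. A x) \<in> uf_sets p \<longleftrightarrow> (\<exists>x\<in>G. A x \<in> uf_sets p)"
proof -
  have "(\<Union>x\<in>G. A x) \<in> uf_sets p \<longleftrightarrow> (\<Inter>x\<in>G. - A x) \<notin> uf_sets p"
    by (simp flip: uf_sets_Compl)
  also have "\<dots> \<longleftrightarrow> (\<exists>x\<in>G. A x \<in> uf_sets p)"
    using assms by (simp add: uf_sets_finite_Inter image_subset_iff uf_sets_Compl)
  finally show ?thesis .
qed

text \<open>Finer filters are smaller in the order on filters, so a minimal proper filter below
  \<open>F\<close> is sought.\<close>

lemma ex_finer_ultrafilter:
  fixes F :: "'a filter"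
  assumes "F \<noteq> bot"
  obtains p where "members F \<subseteq> uf_sets p"
proof -
  have "{H. H \<noteq> bot \<and> H \<le> F} \<noteq> {}"
    using assms by auto
  moreover have "\<exists>l\<in>{H. H \<noteq> bot \<and> H \<le> F}. \<forall>x\<in>C. l \<le> x"
    if C: "C \<subseteq> {H. H \<noteq> bot \<and> H \<le> F}" "C \<noteq> {}"
      and ch: "\<And>x y. x \<in> C \<Longrightarrow> y \<in> C \<Longrightarrow> x \<le> y \<or> y \<le> x" for C
  proof (rule bexI[of _ "Inf C"])
    \<comment> \<open>A finite nonempty subset of a chain attains its infimum; only the empty
      subset, with infimum \<open>top\<close>, is treated apart.\<close>
    have "Inf B \<in> C" if "finite B" "B \<noteq> {}" "B \<subseteq> C" for B
      using that
    proof (induction rule: finite_ne_induct)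
      case (insert x B)
      with ch[of x "Inf B"] show ?case by (auto simp: inf_absorb1 inf_absorb2)
    qed auto
    moreover have "(top :: 'a filter) \<noteq> bot"
      using assms by (metis bot.extremum_uniqueI top_greatest)
    ultimately have "Inf B \<noteq> bot" if "finite B" "B \<subseteq> C" for B
      using that C(1) by (cases "B = {}") auto
    then have "Inf C \<noteq> bot"
      by (rule Inf_filter_not_bot)
    moreover obtain H where "H \<in> C" "H \<le> F" using C by auto
    then have "Inf C \<le> F" by (rule Inf_lower2)
    ultimately show "Inf C \<in> {H. H \<noteq> bot \<and> H \<le> F}" by simp
  qed (simp add: Inf_lower)
  ultimately have "\<exists>H\<in>{H. H \<noteq> bot \<and> H \<le> F}. \<forall>K\<in>{H. H \<noteq> bot \<and> H \<le> F}. K \<le> H \<longrightarrow> K = H"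
    by (rule Zorn_minimal)
  then obtain H where H: "H \<noteq> bot" "H \<le> F"
    and min: "\<And>K. K \<noteq> bot \<Longrightarrow> K \<le> F \<Longrightarrow> K \<le> H \<Longrightarrow> K = H"
    by blast
  have "is_ultrafilter H"
    unfolding is_ultrafilter_def
  proof (intro conjI allI)
    fix A
    show "A \<in> members H \<or> - A \<in> members H"
    \<comment> \<open>If the meet is trivial, \<open>H\<close> contains \<open>- A\<close>;
      otherwise minimality forces the meet to be \<open>H\<close>, which therefore contains
      \<open>A\<close>.\<close>
    proof (cases "inf H (principal A) = bot")
      case True
      then show ?thesis
        by (simp add: members_def trivial_limit_def eventually_inf_principal)
    next
      case False
      then have "inf H (principal A) = H"
        using H by (intro min) (auto intro: order_trans[OF inf_le1])
      then have "H \<le> principal A" by (metis inf_le2)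
      then show ?thesis by (simp add: members_def le_principal)
    qed
  qed fact
  then have "uf_sets (Abs_ultrafilter H) = members H"
    by (simp add: uf_sets_def Abs_ultrafilter_inverse)
  then show ?thesis
    using H by (intro that[of "Abs_ultrafilter H"]) (auto simp: members_def le_filter_def)
qed

text \<open>The infimum of the principal filters is the filter generated by \<open>\<C>\<close>, and
  the finite intersection property makes it proper.\<close>

lemma ex_ultrafilter:
  assumes "\<And>\<B>. finite \<B> \<Longrightarrow> \<B> \<subseteq> \<C> \<Longrightarrow> \<Inter>\<B> \<noteq> {}"
  obtains p where "\<C> \<subseteq> uf_sets p"
proof -
  have "(INF A\<in>\<C>. principal A) \<noteq> bot"
  proof (rule INF_filter_not_bot)
    show "(INF A\<in>\<B>. principal A) \<noteq> bot" if "\<B> \<subseteq> \<C>" "finite \<B>" for \<B>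
      using assms[OF that(2,1)] that by (simp add: INF_principal_finite principal_eq_bot_iff)
  qed
  then obtain p where p: "members (INF A\<in>\<C>. principal A) \<subseteq> uf_sets p"
    by (rule ex_finer_ultrafilter)
  have "A \<in> members (INF A\<in>\<C>. principal A)" if "A \<in> \<C>" for A
    unfolding members_def mem_Collect_eq le_principal[symmetric] using that by (rule INF_lower)
  with p show ?thesis by (intro that) auto
qed

text \<open>If \<open>D\<close> is not in \<open>F\<close>, then \<open>F\<close> and
  \<open>- D\<close> generate a proper filter, and an ultrafilter refining it omits
  \<open>D\<close>. This is how a set that lies in all points of T is recognised as a member of
  \<open>F\<close>.\<close>

lemma members_iff_filter_closure:
  "D \<in> members F \<longleftrightarrow> (\<forall>p\<in>filter_closure F. D \<in> uf_sets p)"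
proof
  assume *: "\<forall>p\<in>filter_closure F. D \<in> uf_sets p"
  show "D \<in> members F"
  proof (rule ccontr)
    assume "D \<notin> members F"
    then have "inf F (principal (- D)) \<noteq> bot"
      by (simp add: members_def trivial_limit_def eventually_inf_principal)
    then obtain p where p: "members (inf F (principal (- D))) \<subseteq> uf_sets p"
      by (rule ex_finer_ultrafilter)
    have "members F \<subseteq> members (inf F (principal (- D)))"
      by (auto simp: members_def eventually_inf_principal elim: eventually_mono)
    moreover have "- D \<in> members (inf F (principal (- D)))"
      by (simp add: members_def eventually_inf_principal)
    ultimately show False
      using p * by (fastforce simp: filter_closure_def uf_sets_Compl)
  qed
qed (auto simp: filter_closure_def)

section \<open>The topology of the space of ultrafilters\<close>

lemma basic_set_Compl: "basic_set (- A) = - basic_set A"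
  by (auto simp: basic_set_def uf_sets_Compl)

lemma open_basic_set: "open (basic_set A)"
  by (auto simp: open_ultrafilter_def)

text \<open>Closed sets are intersections of basic sets, so the given closed sets are replaced by
  the sets \<open>A\<close> whose basic set contains one of them. An ultrafilter containing all
  these \<open>A\<close> lies in every closed set of the family.\<close>

lemma compact_ultrafilter: "compact (UNIV :: 'a ultrafilter set)"
  unfolding compact_fip
proof (intro allI impI)
  fix \<K> :: "'a ultrafilter set set"
  assume cl: "\<forall>C\<in>\<K>. closed C"
    and fip: "\<forall>\<B>\<subseteq>\<K>. finite \<B> \<longrightarrow> UNIV \<inter> \<Inter>\<B> \<noteq> {}"
  let ?\<C> = "{A. \<exists>C\<in>\<K>. C \<subseteq> basic_set A}"
  have "\<Inter>\<B> \<noteq> {}" if "finite \<B>" "\<B> \<subseteq> ?\<C>" for \<B>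
  proof -
    have "\<forall>A\<in>\<B>. \<exists>C\<in>\<K>. C \<subseteq> basic_set A" using that by auto
    then obtain c where c: "\<And>A. A \<in> \<B> \<Longrightarrow> c A \<in> \<K> \<and> c A \<subseteq> basic_set A" by metis
    have "\<Inter>(c ` \<B>) \<noteq> {}"
      using fip[rule_format, of "c ` \<B>"] c that by auto
    then obtain p where "p \<in> \<Inter>(c ` \<B>)" by blast
    then have "\<B> \<subseteq> uf_sets p"
      using c by (auto simp: basic_set_def)
    then show ?thesis
      using that uf_sets_finite_Inter[of \<B> p] uf_sets_empty[of p] by metis
  qed
  then obtain p where p: "?\<C> \<subseteq> uf_sets p" by (rule ex_ultrafilter)
  have "p \<in> C" if "C \<in> \<K>" for C
  proof (rule ccontr)
    assume "p \<notin> C"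
    moreover have "open (- C)" using cl that by auto
    ultimately obtain A where A: "p \<in> basic_set A" "basic_set A \<subseteq> - C"
      unfolding open_ultrafilter_def by blast
    then have "C \<subseteq> basic_set (- A)"
      by (auto simp: basic_set_def uf_sets_Compl)
    with that p have "- A \<in> uf_sets p" by auto
    with A show False by (simp add: basic_set_def uf_sets_Compl)
  qed
  then show "UNIV \<inter> \<Inter>\<K> \<noteq> {}" by auto
qed

instance ultrafilter :: (type) t2_space
proof
  fix p q :: "'a ultrafilter"
  assume "p \<noteq> q"
  then have "uf_sets p \<noteq> uf_sets q" by (simp add: uf_sets_inject)
  then obtain A where "A \<in> uf_sets p \<longleftrightarrow> A \<notin> uf_sets q"
    unfolding set_eq_iff by metis
  then have A: "p \<in> basic_set A \<and> q \<in> - basic_set A \<or> p \<in> - basic_set A \<and> q \<in> basic_set A"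
    by (cases "A \<in> uf_sets p") (simp_all add: basic_set_def)
  have "open (basic_set A)" "open (- basic_set A)"
    unfolding basic_set_Compl[symmetric] by (rule open_basic_set)+
  with A show "\<exists>U V. open U \<and> open V \<and> p \<in> U \<and> q \<in> V \<and> U \<inter> V = {}"
    by (metis Compl_disjoint Compl_disjoint2)
qed

text \<open>The preimage of a basic set is again basic. This is the right topological property: the
  left factor varies.\<close>

lemma continuous_on_ultrafilter_mult_left: "continuous_on S (\<lambda>p::'a::times ultrafilter. p * q)"
proof -
  have "open ((\<lambda>p. p * q) -` U)" if U: "open U" for U
    unfolding open_ultrafilter_def
  proof
    fix p assume "p \<in> (\<lambda>p. p * q) -` U"
    then obtain A where A: "p * q \<in> basic_set A" "basic_set A \<subseteq> U"
      using U unfolding open_ultrafilter_def by blast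
    have "basic_set {x. left_quot x A \<in> uf_sets q} = (\<lambda>p. p * q) -` basic_set A"
      by (auto simp: basic_set_def uf_sets_times)
    with A show "\<exists>B. p \<in> basic_set B \<and> basic_set B \<subseteq> (\<lambda>p. p * q) -` U"
      by (intro exI[of _ "{x. left_quot x A \<in> uf_sets q}"]) auto
  qed
  then have "continuous_on UNIV (\<lambda>p. p * q)"
    by (simp add: continuous_on_open_vimage)
  then show ?thesis by (rule continuous_on_subset) simp
qed

section \<open>The smallest ideal\<close>

text \<open>Inside T q there is a minimal closed left ideal \<open>L\<close>. For any of its points
  r q and any y in T, the set T y r q is a closed left ideal inside \<open>L\<close>, so it equals
  \<open>L\<close> and contains r q.\<close>

lemma ex_minimal_point:
  fixes T :: "'b::{t2_space, semigroup_mult} set"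
  assumes T: "compact T" "\<And>s t. s \<in> T \<Longrightarrow> t \<in> T \<Longrightarrow> s * t \<in> T"
    and cont: "\<And>q. q \<in> T \<Longrightarrow> continuous_on T (\<lambda>x. x * q)"
    and q: "q \<in> T"
  obtains r where "r \<in> T" "\<And>y. y \<in> T \<Longrightarrow> \<exists>s\<in>T. r * q = s * y * (r * q)"
proof -
  define \<L> where "\<L> = {L. L \<noteq> {} \<and> closed L \<and> L \<subseteq> (\<lambda>t. t * q) ` T \<and> (\<forall>t\<in>T. \<forall>x\<in>L. t * x \<in> L)}"
  have closed_orbit: "closed ((\<lambda>t. t * x) ` T)" if "x \<in> T" for x
    using that T cont by (intro compact_imp_closed compact_continuous_image)
  have orbit_sub: "(\<lambda>t. t * q) ` T \<subseteq> T"
    using T q by auto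
  have "(\<lambda>t. t * q) ` T \<in> \<L>"
    unfolding \<L>_def using q T closed_orbit
    by (auto simp: image_iff intro!: bexI mult.assoc[symmetric])
  then have "\<L> \<noteq> {}" by blast
  moreover have "\<exists>L\<in>\<L>. \<forall>x\<in>C. L \<subseteq> x"
    if C: "C \<subseteq> \<L>" "C \<noteq> {}" and ch: "\<And>x y. x \<in> C \<Longrightarrow> y \<in> C \<Longrightarrow> x \<subseteq> y \<or> y \<subseteq> x" for C
  proof (rule bexI[of _ "\<Inter>C"])
    have "\<Inter>B \<in> C" if "finite B" "B \<noteq> {}" "B \<subseteq> C" for B
      using that
    proof (induction rule: finite_ne_induct)
      case (insert x B)
      with ch[of x "\<Inter>B"] show ?case by (auto simp: inf_absorb1 inf_absorb2)
    qed auto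
    moreover have "L \<noteq> {} \<and> L \<subseteq> T" if "L \<in> C" for L
      using that C(1) orbit_sub by (force simp: \<L>_def)
    \<comment> \<open>Compactness of \<open>T\<close> turns this into a nonempty intersection of the
      whole chain; for empty \<open>B\<close> the point \<open>q\<close> is a witness.\<close>
    ultimately have fip: "T \<inter> \<Inter>B \<noteq> {}" if "finite B" "B \<subseteq> C" for B
      using that q by (cases "B = {}") (auto simp: Int_absorb1)
    have closed: "closed L" if "L \<in> C" for L
      using that C by (auto simp: \<L>_def)
    have "T \<inter> \<Inter>C \<noteq> {}"
      using T(1) closed fip by (rule compact_imp_fip)
    then have "\<Inter>C \<noteq> {}" by blast
    moreover have "closed (\<Inter>C)"
      using closed by (rule closed_Inter[rule_format])
    moreover have "\<Inter>C \<subseteq> (\<lambda>t. t * q) ` T"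
      using C by (auto 0 3 simp: \<L>_def)
    moreover have "\<forall>t\<in>T. \<forall>x\<in>\<Inter>C. t * x \<in> \<Inter>C"
      using C(1) by (auto simp: \<L>_def)
    ultimately show "\<Inter>C \<in> \<L>"
      by (simp add: \<L>_def)
  qed auto
  ultimately have "\<exists>L\<in>\<L>. \<forall>K\<in>\<L>. K \<subseteq> L \<longrightarrow> K = L"
    by (rule Zorn_minimal)
  then obtain L where L: "L \<in> \<L>" and min: "\<And>K. K \<in> \<L> \<Longrightarrow> K \<subseteq> L \<Longrightarrow> K = L"
    by blast
  from L have "L \<noteq> {}" "L \<subseteq> (\<lambda>t. t * q) ` T" by (auto simp: \<L>_def)
  then obtain r where r: "r \<in> T" "r * q \<in> L" by blast
  have "\<exists>s\<in>T. r * q = s * y * (r * q)" if y: "y \<in> T" for y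
  proof -
    let ?x = "y * (r * q)"
    have x: "?x \<in> L" using L r y by (auto simp: \<L>_def)
    with L orbit_sub have "?x \<in> T" unfolding \<L>_def by blast
    moreover have sub: "(\<lambda>t. t * ?x) ` T \<subseteq> L" using L x by (auto simp: \<L>_def)
    ultimately have "(\<lambda>t. t * ?x) ` T \<in> \<L>"
      using L T q closed_orbit unfolding \<L>_def
      by (auto simp: image_iff intro!: bexI mult.assoc[symmetric])
    then have "(\<lambda>t. t * ?x) ` T = L" using sub by (rule min)
    with r(2) show ?thesis by (auto simp: mult.assoc)
  qed
  with r show ?thesis by (intro that)
qed

text \<open>The condition x \<in> T y x for all y says that x lies in a minimal left ideal.\<close>

lemma two_sided_ideal_minimal_points:
  fixes T :: "'b::{t2_space, semigroup_mult} set"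
  assumes T: "compact T" "T \<noteq> {}" "\<And>s t. s \<in> T \<Longrightarrow> t \<in> T \<Longrightarrow> s * t \<in> T"
    and cont: "\<And>q. q \<in> T \<Longrightarrow> continuous_on T (\<lambda>x. x * q)"
  shows "two_sided_ideal T {x \<in> T. \<forall>y\<in>T. \<exists>s\<in>T. x = s * y * x}"
proof -
  let ?M = "{x \<in> T. \<forall>y\<in>T. \<exists>s\<in>T. x = s * y * x}"
  obtain q where q: "q \<in> T" using T by auto
  obtain r where "r \<in> T" "\<And>y. y \<in> T \<Longrightarrow> \<exists>s\<in>T. r * q = s * y * (r * q)"
    using ex_minimal_point[OF T(1,3) cont q] by blast
  then have "r * q \<in> ?M" using q T by auto
  moreover have "t * x \<in> ?M" "x * t \<in> ?M" if t: "t \<in> T" and x: "x \<in> ?M" for t x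
  proof -
    have "\<exists>s\<in>T. t * x = s * y * (t * x)" if y: "y \<in> T" for y
    proof -
      \<comment> \<open>Minimality is used at \<open>y * t\<close>, so that multiplying by
        \<open>t\<close> on the left reproduces \<open>t * x\<close> on both sides.\<close>
      obtain s where s: "s \<in> T" "x = s * (y * t) * x" using x T t y by blast
      then have "t * x = (t * s) * y * (t * x)" by (metis mult.assoc)
      then show ?thesis using T(3)[OF t s(1)] by blast
    qed
    then show "t * x \<in> ?M" using T t x by auto
    have "\<exists>s\<in>T. x * t = s * y * (x * t)" if y: "y \<in> T" for y
    proof -
      obtain s where s: "s \<in> T" "x = s * y * x" using x y by blast
      then have "x * t = s * y * (x * t)" by (metis mult.assoc)
      with s show ?thesis by blast
    qed
    then show "x * t \<in> ?M" using T t x by auto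
  qed
  ultimately show ?thesis
    unfolding two_sided_ideal_def by blast
qed

text \<open>Any two-sided ideal contains some \<open>i\<close>, and a minimal point x = s i x is
  thereby absorbed into that ideal.\<close>

lemma smallest_ideal_eq:
  fixes T :: "'b::{t2_space, semigroup_mult} set"
  assumes "compact T" "T \<noteq> {}" "\<And>s t. s \<in> T \<Longrightarrow> t \<in> T \<Longrightarrow> s * t \<in> T"
    and "\<And>q. q \<in> T \<Longrightarrow> continuous_on T (\<lambda>x. x * q)"
  shows "smallest_ideal T = {x \<in> T. \<forall>y\<in>T. \<exists>s\<in>T. x = s * y * x}"
  unfolding smallest_ideal_def
proof (rule Least_equality)
  let ?M = "{x \<in> T. \<forall>y\<in>T. \<exists>s\<in>T. x = s * y * x}"
  show "two_sided_ideal T ?M"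
    using assms by (rule two_sided_ideal_minimal_points)
  show "?M \<subseteq> I" if I: "two_sided_ideal T I" for I
  proof
    fix x assume x: "x \<in> ?M"
    obtain i where i: "i \<in> I" "i \<in> T" using I by (auto simp: two_sided_ideal_def)
    then obtain s where s: "s \<in> T" "x = s * i * x" using x by blast
    have "s * i * x \<in> I" using I i(1) s(1) x unfolding two_sided_ideal_def by blast
    then show "x \<in> I" using s(2) by simp
  qed
qed

section \<open>Collectionwise piecewise syndetic families\<close>

lemma left_quot_Left_quot: "left_quot y (Left_quot G A) = (\<Union>x\<in>G. left_quot y (left_quot x A))"
  by (auto simp: left_quot_def Left_quot_def)

lemma ex_syndetic_witness:
  fixes F :: "'a::semigroup_mult filter"
  assumes T: "compact (filter_closure F)" "filter_closure F \<noteq> {}"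
    and p: "\<And>r. r \<in> filter_closure F \<Longrightarrow> \<exists>s\<in>filter_closure F. p = s * r * p"
    and A: "A \<in> uf_sets p"
    and V: "V \<in> members F"
  obtains G where "G \<in> finite_nonempty_subsets V" "{y. left_quot y (Left_quot G A) \<in> uf_sets p} \<in> members F"
proof -
  let ?D = "\<lambda>x. {y. left_quot y (left_quot x A) \<in> uf_sets p}"
  have "filter_closure F \<subseteq> (\<Union>x\<in>V. basic_set (?D x))"
  proof
    fix r assume r: "r \<in> filter_closure F"
    then obtain s where s: "s \<in> filter_closure F" "p = s * (r * p)"
      using p by (auto simp: mult.assoc)
    \<comment> \<open>Since \<open>s\<close> extends \<open>F\<close>, it contains \<open>V\<close>;
      this allows x to be taken inside \<open>V\<close>.\<close>
    then have "{x. left_quot x A \<in> uf_sets (r * p)} \<inter> V \<in> uf_sets s"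
      using A V by (auto simp: uf_sets_Int filter_closure_def simp flip: uf_sets_times)
    then obtain x where "x \<in> V" "left_quot x A \<in> uf_sets (r * p)"
      using uf_sets_empty[of s] by (metis (no_types, lifting) Int_iff equals0I mem_Collect_eq)
    then show "r \<in> (\<Union>x\<in>V. basic_set (?D x))"
      by (auto simp: basic_set_def uf_sets_times)
  qed
  then obtain G where G: "G \<subseteq> V" "finite G" "filter_closure F \<subseteq> (\<Union>x\<in>G. basic_set (?D x))"
    using T(1) open_basic_set by (metis (no_types, lifting) compactE_image)
  have "{y. left_quot y (Left_quot G A) \<in> uf_sets p} \<in> uf_sets r" if r: "r \<in> filter_closure F" for r
  proof -
    obtain x where "x \<in> G" "?D x \<in> uf_sets r" using G r by (auto simp: basic_set_def)
    then show ?thesis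
      by (elim uf_sets_mono) (auto simp: left_quot_Left_quot elim: uf_sets_mono)
  qed
  moreover have "G \<noteq> {}" using G T(2) by auto
  ultimately show ?thesis
    using G by (intro that[of G]) (auto simp: finite_nonempty_subsets_def members_iff_filter_closure)
qed

theorem theorem5p2:
  fixes T :: "'a::semigroup_mult ultrafilter set"
    and F :: "'a filter"
    and \<A> :: "'a set set"
  assumes "closed_subsemigroup T"
    and "F \<noteq> bot"
    and "filter_closure F = T"
  shows "(\<exists>p\<in>smallest_ideal T. \<A> \<subseteq> uf_sets p) \<longleftrightarrow> collectionwise_piecewise_syndetic F \<A>"
proof -
  have ne: "T \<noteq> {}" and mult: "\<And>s t. s \<in> T \<Longrightarrow> t \<in> T \<Longrightarrow> s * t \<in> T"
    using assms(1) by (auto simp: closed_subsemigroup_def)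
  have comp: "compact T"
    using compact_Int_closed[OF compact_ultrafilter, of T] assms(1)
    by (simp add: closed_subsemigroup_def)
  note cont = continuous_on_ultrafilter_mult_left
  have K: "smallest_ideal T = {x \<in> T. \<forall>y\<in>T. \<exists>s\<in>T. x = s * y * x}"
    using comp ne mult cont by (rule smallest_ideal_eq)
  have ideal: "two_sided_ideal T (smallest_ideal T)"
    unfolding K using comp ne mult cont by (rule two_sided_ideal_minimal_points)
  have memT: "r \<in> T \<longleftrightarrow> members F \<subseteq> uf_sets r" for r
    using assms(3) by (auto simp: filter_closure_def)
  show ?thesis
  proof
    assume "\<exists>p\<in>smallest_ideal T. \<A> \<subseteq> uf_sets p"
    then obtain p where pT: "p \<in> T" and p: "\<And>y. y \<in> T \<Longrightarrow> \<exists>s\<in>T. p = s * y * p"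
      and \<A>: "\<A> \<subseteq> uf_sets p"
      using K by auto
    let ?\<delta> = "\<lambda>G \<B>. {y. left_quot y (Left_quot G (\<Inter>\<B>)) \<in> uf_sets p}"
    have "\<exists>G. G \<in> finite_nonempty_subsets V \<and> ?\<delta> G \<B> \<in> members F"
      if "V \<in> members F" "\<B> \<in> finite_nonempty_subsets \<A>" for V \<B>
    proof -
      have "\<Inter>\<B> \<in> uf_sets p"
        using that \<A> by (auto simp: uf_sets_finite_Inter finite_nonempty_subsets_def)
      then show ?thesis
        using ex_syndetic_witness[of F p "\<Inter>\<B>" V] comp ne p assms(3) that by blast
    qed
    then obtain G where G: "\<And>V \<B>. V \<in> members F \<Longrightarrow> \<B> \<in> finite_nonempty_subsets \<A> \<Longrightarrow>
        G V \<B> \<in> finite_nonempty_subsets V \<and> ?\<delta> (G V \<B>) \<B> \<in> members F"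
      by metis
    let ?\<C> = "{left_quot y (Left_quot (G V \<B>) (\<Inter>\<B>)) \<inter> V | V y \<B>.
        V \<in> members F \<and> \<B> \<in> finite_nonempty_subsets \<A> \<and> y \<in> ?\<delta> (G V \<B>) \<B>}"
    have "?\<C> \<subseteq> uf_sets p"
      using pT by (auto simp: uf_sets_Int memT)
    then have "\<Inter>\<D> \<noteq> {}" if "\<D> \<in> finite_nonempty_subsets ?\<C>" for \<D>
      using that uf_sets_finite_Inter[of \<D> p] uf_sets_empty[of p]
      unfolding finite_nonempty_subsets_def[of ?\<C>] by (metis (no_types, lifting) mem_Collect_eq order_trans)
    then have "finite_intersection_property ?\<C>"
      unfolding finite_intersection_property_def by blast
    then show "collectionwise_piecewise_syndetic F \<A>"
      unfolding collectionwise_piecewise_syndetic_def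
      by (intro exI[of _ G] exI[of _ "\<lambda>V \<B>. ?\<delta> (G V \<B>) \<B>"]) (use G in auto)
  next
    assume "collectionwise_piecewise_syndetic F \<A>"
    then obtain G \<delta> where
      G: "\<And>V \<B>. V \<in> members F \<Longrightarrow> \<B> \<in> finite_nonempty_subsets \<A> \<Longrightarrow> G V \<B> \<in> finite_nonempty_subsets V"
      and \<delta>: "\<And>V \<B>. V \<in> members F \<Longrightarrow> \<B> \<in> finite_nonempty_subsets \<A> \<Longrightarrow> \<delta> V \<B> \<in> members F"
      and fip: "finite_intersection_property
          {left_quot y (Left_quot (G V \<B>) (\<Inter>\<B>)) \<inter> V | V y \<B>.
             V \<in> members F \<and> \<B> \<in> finite_nonempty_subsets \<A> \<and> y \<in> \<delta> V \<B>}"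
        (is "finite_intersection_property ?\<C>")
      unfolding collectionwise_piecewise_syndetic_def by blast
    show "\<exists>p\<in>smallest_ideal T. \<A> \<subseteq> uf_sets p"
    \<comment> \<open>With no nonempty finite subfamilies the hypothesis gives nothing, but any
      point of K(T) will do.\<close>
    proof (cases "\<A> = {}")
      case True
      with ideal show ?thesis by (auto simp: two_sided_ideal_def)
    next
      case False
      have "\<Inter>\<D> \<noteq> {}" if "finite \<D>" "\<D> \<subseteq> ?\<C>" for \<D>
      proof (cases "\<D> = {}")
        case False
        with that have "\<D> \<in> finite_nonempty_subsets ?\<C>"
          unfolding finite_nonempty_subsets_def[of ?\<C>] by blast
        with fip show ?thesis unfolding finite_intersection_property_def by blast
      qed simp
      then obtain q where q: "?\<C> \<subseteq> uf_sets q" by (rule ex_ultrafilter)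
      have qD: "left_quot y (Left_quot (G V \<B>) (\<Inter>\<B>)) \<in> uf_sets q \<and> V \<in> uf_sets q"
        if "V \<in> members F" "\<B> \<in> finite_nonempty_subsets \<A>" "y \<in> \<delta> V \<B>" for V \<B> y
        unfolding uf_sets_Int[symmetric] using q that by blast
      \<comment> \<open>The singleton of \<open>A\<close> makes the family mention every
        \<open>V\<close> in \<open>F\<close>: \<open>\<delta> V {A}\<close> is nonempty because
        \<open>F\<close> is proper. Hence \<open>q\<close> extends \<open>F\<close>.\<close>
      obtain A where "A \<in> \<A>" using False by blast
      then have A: "{A} \<in> finite_nonempty_subsets \<A>"
        by (simp add: finite_nonempty_subsets_def)
      have "{} \<notin> members F"
        using assms(2) by (simp add: members_def trivial_limit_def)
      then have "V \<in> uf_sets q" if "V \<in> members F" for V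
        using qD[OF that A] \<delta>[OF that A] by (metis all_not_in_conv)
      then have qT: "q \<in> T" by (auto simp: memT)
      obtain r where "r \<in> smallest_ideal T" using ideal by (auto simp: two_sided_ideal_def)
      then have r: "r \<in> T" and u: "r * q \<in> smallest_ideal T"
        using ideal qT by (auto simp: two_sided_ideal_def)
      let ?u = "r * q"
      let ?E = "\<lambda>A. {x. left_quot x A \<in> uf_sets ?u}"
      have E: "?E (\<Inter>\<B>) \<inter> V \<noteq> {}" if V: "V \<in> members F" and \<B>: "\<B> \<in> finite_nonempty_subsets \<A>" for V \<B>
      proof -
        have "\<delta> V \<B> \<in> uf_sets r" using \<delta>[OF V \<B>] r by (auto simp: memT)
        then have "{y. left_quot y (Left_quot (G V \<B>) (\<Inter>\<B>)) \<in> uf_sets q} \<in> uf_sets r"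
          by (rule uf_sets_mono) (use qD[OF V \<B>] in auto)
        \<comment> \<open>The union is finite, so one of its sets is in \<open>r * q\<close>, and
          its index x lies in \<open>V\<close>.\<close>
        then have "(\<Union>x\<in>G V \<B>. left_quot x (\<Inter>\<B>)) \<in> uf_sets ?u"
          by (simp add: uf_sets_times Left_quot_def)
        then show ?thesis
          using G[OF V \<B>] by (auto simp: uf_sets_finite_UN finite_nonempty_subsets_def)
      qed
      have "\<Inter>\<D> \<noteq> {}" if "finite \<D>" "\<D> \<subseteq> members F \<union> ?E ` \<A>" for \<D>
      proof -
        \<comment> \<open>The finitely many sets are split: those in \<open>F\<close> are merged
          into one \<open>V\<close>, and the others come from a finite \<open>\<B>\<^sub>0\<close>,
          so one point given by \<open>E\<close> handles all of them.\<close>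
        define V where "V = \<Inter>(\<D> \<inter> members F)"
        have "finite (\<D> - members F)" "\<D> - members F \<subseteq> ?E ` \<A>"
          using that by auto
        from finite_subset_image[OF this] obtain \<B>\<^sub>0
          where \<B>\<^sub>0: "\<B>\<^sub>0 \<subseteq> \<A>" "finite \<B>\<^sub>0" "\<D> - members F = ?E ` \<B>\<^sub>0"
          by (elim exE conjE)
        \<comment> \<open>Inserting \<open>A\<close> keeps the subfamily nonempty even if
          \<open>\<B>\<^sub>0\<close> is empty.\<close>
        have "insert A \<B>\<^sub>0 \<in> finite_nonempty_subsets \<A>"
          using \<B>\<^sub>0 \<open>A \<in> \<A>\<close> by (simp add: finite_nonempty_subsets_def)
        moreover have "V \<in> members F"
          unfolding V_def members_iff_filter_closure
          using that by (auto simp: uf_sets_finite_Inter filter_closure_def)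
        ultimately obtain x where x: "x \<in> ?E (\<Inter>(insert A \<B>\<^sub>0))" "x \<in> V"
          using E by blast
        have "x \<in> ?E B" if "B \<in> \<B>\<^sub>0" for B
          using x(1) that by (auto simp: left_quot_def elim!: uf_sets_mono)
        then have "x \<in> D" if "D \<in> \<D> - members F" for D
          using that unfolding \<B>\<^sub>0(3) by blast
        then have "x \<in> D" if "D \<in> \<D>" for D
          using x(2) that unfolding V_def by (cases "D \<in> members F") auto
        then show ?thesis by auto
      qed
      then obtain s where s: "members F \<union> ?E ` \<A> \<subseteq> uf_sets s" by (rule ex_ultrafilter)
      then have "s \<in> T" by (simp add: memT)
      then have "s * ?u \<in> smallest_ideal T"
        using ideal u by (auto simp: two_sided_ideal_def)
      moreover have "\<A> \<subseteq> uf_sets (s * ?u)"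
        using s by (auto simp: uf_sets_times[of _ s] image_subset_iff)
      ultimately show ?thesis by blast
    qed
  qed
qed

end
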